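(* Let $G$ be a finite group, $H$ a subgroup of $G$, $A = \mathbb{C}G$ and $B = \mathbb{C}H \subseteq A$. If $A$ is a uniquely split extension of $B$, then $A = B$.
   Context: A ring extension $A \supseteq B$ is uniquely split if there is exactly one bimodule projection from $A$ to $B$, i.e. exactly one $B$-$B$-bimodule homomorphism $F : A \to B$ with $F(1_A) = 1_B$. Here $\mathbb{C}G$ denotes the complex group algebra. *)

theory Defs
  imports Complex_Main "HOL-Algebra.Algebra"
begin

text \<open>
  The complex group algebra of \<open>G\<close>: a formal linear combination of elements of \<open>G\<close> is a
  finitely supported coefficient function that vanishes off \<open>carrier G\<close>, and the product is the
  bilinear extension of the product of \<open>G\<close>.  Since coefficient functions are extended by zero,
  the group algebra of a subgroup is literally a subset of the group algebra of the group.
\<close>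

definition conv :: "('a, 'm) monoid_scheme \<Rightarrow> ('a \<Rightarrow> complex) \<Rightarrow> ('a \<Rightarrow> complex) \<Rightarrow> 'a \<Rightarrow> complex" where
  "conv G f g = (\<lambda>x. \<Sum>y\<in>{y. f y \<noteq> 0}. \<Sum>z\<in>{z. g z \<noteq> 0}.
     if y \<otimes>\<^bsub>G\<^esub> z = x then f y * g z else 0)"

definition group_algebra :: "('a, 'm) monoid_scheme \<Rightarrow> ('a \<Rightarrow> complex) ring" where
  "group_algebra G =
     \<lparr> carrier = {f. finite {x. f x \<noteq> 0} \<and> {x. f x \<noteq> 0} \<subseteq> carrier G},
       monoid.mult = conv G,
       one = (\<lambda>x. if x = \<one>\<^bsub>G\<^esub> then 1 else 0),
       ring.zero = (\<lambda>x. 0),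
       add = (\<lambda>f g x. f x + g x) \<rparr>"

text \<open>
  For a ring extension \<open>A \<supseteq> B\<close>, with \<open>B\<close> given as a subset of \<open>carrier A\<close>: additive maps from
  \<open>A\<close> to \<open>B\<close> commuting with left and right multiplication by elements of \<open>B\<close>.  Maps are taken
  in the extensional function space, so that equality of functions is equality on \<open>carrier A\<close>.
\<close>

definition bimodule_hom :: "('r, 'm) ring_scheme \<Rightarrow> 'r set \<Rightarrow> ('r \<Rightarrow> 'r) set" where
  "bimodule_hom A B = {F \<in> carrier A \<rightarrow>\<^sub>E B.
     (\<forall>x\<in>carrier A. \<forall>y\<in>carrier A. F (x \<oplus>\<^bsub>A\<^esub> y) = F x \<oplus>\<^bsub>A\<^esub> F y) \<and>
     (\<forall>b\<in>B. \<forall>x\<in>carrier A. F (b \<otimes>\<^bsub>A\<^esub> x) = b \<otimes>\<^bsub>A\<^esub> F x) \<and>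
     (\<forall>b\<in>B. \<forall>x\<in>carrier A. F (x \<otimes>\<^bsub>A\<^esub> b) = F x \<otimes>\<^bsub>A\<^esub> b)}"

definition uniquely_split :: "('r, 'm) ring_scheme \<Rightarrow> 'r set \<Rightarrow> bool" where
  "uniquely_split A B \<longleftrightarrow> (\<exists>!F. F \<in> bimodule_hom A B \<and> F \<one>\<^bsub>A\<^esub> = \<one>\<^bsub>A\<^esub>)"

lemma group_algebra_simps:
  "f \<in> carrier (group_algebra G) \<longleftrightarrow> finite {x. f x \<noteq> 0} \<and> {x. f x \<noteq> 0} \<subseteq> carrier G"
  "f \<otimes>\<^bsub>group_algebra G\<^esub> g = conv G f g"
  "\<one>\<^bsub>group_algebra G\<^esub> = (\<lambda>x. if x = \<one>\<^bsub>G\<^esub> then 1 else 0)"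
  "\<zero>\<^bsub>group_algebra G\<^esub> = (\<lambda>x. 0)"
  "f \<oplus>\<^bsub>group_algebra G\<^esub> g = (\<lambda>x. f x + g x)"
  by (simp_all add: group_algebra_def)

lemma conv_superset:
  assumes "finite S" "finite T" "{x. f x \<noteq> 0} \<subseteq> S" "{x. g x \<noteq> 0} \<subseteq> T"
  shows "conv G f g x = (\<Sum>y\<in>S. \<Sum>z\<in>T. if y \<otimes>\<^bsub>G\<^esub> z = x then f y * g z else 0)"
proof -
  have "conv G f g x = (\<Sum>y\<in>{y. f y \<noteq> 0}. \<Sum>z\<in>T. if y \<otimes>\<^bsub>G\<^esub> z = x then f y * g z else 0)"
    unfolding conv_def using assms
    by (intro sum.cong refl sum.mono_neutral_left) (auto)
  also have "\<dots> = (\<Sum>y\<in>S. \<Sum>z\<in>T. if y \<otimes>\<^bsub>G\<^esub> z = x then f y * g z else 0)"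
    using assms by (intro sum.mono_neutral_left) (auto intro!: sum.neutral split: if_splits)
  finally show ?thesis .
qed

lemma conv_support: "{x. conv G f g x \<noteq> 0} \<subseteq>
    (\<lambda>(y, z). y \<otimes>\<^bsub>G\<^esub> z) ` ({y. f y \<noteq> 0} \<times> {z. g z \<noteq> 0})"
proof (rule subsetI, rule ccontr)
  fix x assume x: "x \<in> {x. conv G f g x \<noteq> 0}"
    and n: "x \<notin> (\<lambda>(y, z). y \<otimes>\<^bsub>G\<^esub> z) ` ({y. f y \<noteq> 0} \<times> {z. g z \<noteq> 0})"
  have "conv G f g x = 0"
    unfolding conv_def using n by (intro sum.neutral ballI) (auto simp: image_iff)
  with x show False by simp
qed

lemma (in monoid) conv_closed:
  assumes "f \<in> carrier (group_algebra G)" "g \<in> carrier (group_algebra G)"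
  shows "conv G f g \<in> carrier (group_algebra G)"
  using assms finite_subset[OF conv_support[of G f g]] conv_support[of G f g]
  by (fastforce simp: group_algebra_simps)

lemma (in monoid) conv_assoc:
  assumes "f \<in> carrier (group_algebra G)" "g \<in> carrier (group_algebra G)"
    "h \<in> carrier (group_algebra G)"
  shows "conv G (conv G f g) h = conv G f (conv G g h)"
proof
  fix x
  let ?F = "{x. f x \<noteq> 0}" and ?G = "{x. g x \<noteq> 0}" and ?H = "{x. h x \<noteq> 0}"
  let ?S = "(\<lambda>(y, z). y \<otimes> z) ` (?F \<times> ?G)" and ?T = "(\<lambda>(y, z). y \<otimes> z) ` (?G \<times> ?H)"
  have fin: "finite ?F" "finite ?G" "finite ?H" "finite ?S" "finite ?T"
    and sub: "?F \<subseteq> carrier G" "?G \<subseteq> carrier G" "?H \<subseteq> carrier G"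
    using assms by (auto simp: group_algebra_simps)
  have "conv G (conv G f g) h x =
      (\<Sum>w\<in>?S. \<Sum>c\<in>?H. if w \<otimes> c = x then conv G f g w * h c else 0)"
    by (rule conv_superset[OF fin(4,3) conv_support order_refl])
  also have "\<dots> = (\<Sum>w\<in>?S. \<Sum>c\<in>?H. \<Sum>a\<in>?F. \<Sum>b\<in>?G.
      if a \<otimes> b = w then if w \<otimes> c = x then f a * g b * h c else 0 else 0)"
    by (intro sum.cong refl) (auto simp: conv_def sum_distrib_right intro!: sum.cong sum.neutral)
  also have "\<dots> = (\<Sum>c\<in>?H. \<Sum>a\<in>?F. \<Sum>b\<in>?G. \<Sum>w\<in>?S.
      if a \<otimes> b = w then if w \<otimes> c = x then f a * g b * h c else 0 else 0)"
    by (subst sum.swap, rule sum.cong[OF refl], subst sum.swap, rule sum.cong[OF refl],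
        rule sum.swap)
  also have "\<dots> = (\<Sum>c\<in>?H. \<Sum>a\<in>?F. \<Sum>b\<in>?G.
      if (a \<otimes> b) \<otimes> c = x then f a * g b * h c else 0)"
    by (intro sum.cong refl, subst sum.delta'[OF fin(4)]) auto
  also have "\<dots> = (\<Sum>a\<in>?F. \<Sum>b\<in>?G. \<Sum>c\<in>?H.
      if a \<otimes> (b \<otimes> c) = x then f a * (g b * h c) else 0)"
    using sub by (subst sum.swap, intro sum.cong[OF refl], subst sum.swap, intro sum.cong[OF refl])
      (auto simp: m_assoc subset_iff mult.assoc)
  also have "\<dots> = (\<Sum>a\<in>?F. \<Sum>b\<in>?G. \<Sum>c\<in>?H. \<Sum>w\<in>?T.
      if b \<otimes> c = w then if a \<otimes> w = x then f a * (g b * h c) else 0 else 0)"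
    by (intro sum.cong refl, subst sum.delta'[OF fin(5)]) auto
  also have "\<dots> = (\<Sum>a\<in>?F. \<Sum>w\<in>?T. \<Sum>b\<in>?G. \<Sum>c\<in>?H.
      if b \<otimes> c = w then if a \<otimes> w = x then f a * (g b * h c) else 0 else 0)"
    by (rule sum.cong[OF refl], subst sum.swap[where A = ?T], rule sum.cong[OF refl], rule sum.swap)
  also have "\<dots> = (\<Sum>a\<in>?F. \<Sum>w\<in>?T. if a \<otimes> w = x then f a * conv G g h w else 0)"
    by (intro sum.cong refl) (auto simp: conv_def sum_distrib_left intro!: sum.cong sum.neutral)
  also have "\<dots> = conv G f (conv G g h) x"
    by (rule conv_superset[OF fin(1,5) order_refl conv_support, symmetric])
  finally show "conv G (conv G f g) h x = conv G f (conv G g h) x" .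
qed

lemma group_algebra_add_closed:
  assumes "f \<in> carrier (group_algebra G)" "g \<in> carrier (group_algebra G)"
  shows "(\<lambda>x. f x + g x) \<in> carrier (group_algebra G)"
proof -
  have "{x. f x + g x \<noteq> 0} \<subseteq> {x. f x \<noteq> 0} \<union> {x. g x \<noteq> 0}" by auto
  then show ?thesis
    using assms unfolding group_algebra_simps by (meson finite_UnI finite_subset le_sup_iff order_trans)
qed

lemma conv_add:
  assumes "f \<in> carrier (group_algebra G)" "g \<in> carrier (group_algebra G)"
    "h \<in> carrier (group_algebra G)"
  shows "conv G (\<lambda>x. f x + g x) h = (\<lambda>x. conv G f h x + conv G g h x)"
    and "conv G h (\<lambda>x. f x + g x) = (\<lambda>x. conv G h f x + conv G h g x)"
proof -
  let ?S = "{x. f x \<noteq> 0} \<union> {x. g x \<noteq> 0}" and ?H = "{x. h x \<noteq> 0}"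
  have fin: "finite ?S" "finite ?H" using assms by (auto simp: group_algebra_simps)
  note e = conv_superset[OF fin] conv_superset[OF fin(2,1)]
  have sub: "{x. f x \<noteq> 0} \<subseteq> ?S" "{x. g x \<noteq> 0} \<subseteq> ?S" "{x. f x + g x \<noteq> 0} \<subseteq> ?S" by auto
  show "conv G (\<lambda>x. f x + g x) h = (\<lambda>x. conv G f h x + conv G g h x)"
    by (rule ext, subst e(1)[OF sub(3) order_refl], subst e(1)[OF sub(1) order_refl],
        subst e(1)[OF sub(2) order_refl], unfold sum.distrib[symmetric], intro sum.cong refl)
      (simp add: distrib_right)
  show "conv G h (\<lambda>x. f x + g x) = (\<lambda>x. conv G h f x + conv G h g x)"
    by (rule ext, subst e(2)[OF order_refl sub(3)], subst e(2)[OF order_refl sub(1)],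
        subst e(2)[OF order_refl sub(2)], unfold sum.distrib[symmetric], intro sum.cong refl)
      (simp add: distrib_left)
qed

lemma (in monoid) conv_one:
  assumes "f \<in> carrier (group_algebra G)"
  shows "conv G (\<lambda>x. if x = \<one> then 1 else 0) f = f"
    and "conv G f (\<lambda>x. if x = \<one> then 1 else 0) = f"
proof -
  let ?F = "{x. f x \<noteq> 0}"
  have fin: "finite ?F" and sub: "?F \<subseteq> carrier G" using assms by (auto simp: group_algebra_simps)
  have 1: "{x. (if x = \<one> then 1 else 0 :: complex) \<noteq> 0} \<subseteq> {\<one>}" by auto
  have d: "(\<Sum>z\<in>?F. if z = x then f z else 0) = f x" for x
    using fin by simp
  show "conv G (\<lambda>x. if x = \<one> then 1 else 0) f = f"
  proof
    fix x
    have "conv G (\<lambda>x. if x = \<one> then 1 else 0) f x = (\<Sum>z\<in>?F. if z = x then f z else 0)"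
      by (subst conv_superset[OF _ fin 1 order_refl], simp, simp, rule sum.cong[OF refl])
        (use sub in auto)
    then show "conv G (\<lambda>x. if x = \<one> then 1 else 0) f x = f x" using d by simp
  qed
  show "conv G f (\<lambda>x. if x = \<one> then 1 else 0) = f"
  proof
    fix x
    have "conv G f (\<lambda>x. if x = \<one> then 1 else 0) x = (\<Sum>z\<in>?F. if z = x then f z else 0)"
      by (subst conv_superset[OF fin _ order_refl 1], simp, simp, rule sum.cong[OF refl])
        (use sub in auto)
    then show "conv G f (\<lambda>x. if x = \<one> then 1 else 0) x = f x" using d by simp
  qed
qed

lemma (in monoid) ring_group_algebra: "ring (group_algebra G)"
proof (rule ringI)
  show "abelian_group (group_algebra G)"
  proof (rule abelian_groupI)
    fix f assume f: "f \<in> carrier (group_algebra G)"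
    show "\<exists>g\<in>carrier (group_algebra G). g \<oplus>\<^bsub>group_algebra G\<^esub> f = \<zero>\<^bsub>group_algebra G\<^esub>"
      by (rule bexI[of _ "\<lambda>x. - f x"]) (use f in \<open>auto simp: group_algebra_simps\<close>)
  qed (auto simp: group_algebra_simps(2-5) group_algebra_add_closed add_ac, 
       simp_all add: group_algebra_simps)
  show "monoid (group_algebra G)"
    by (rule monoidI; (unfold group_algebra_simps(2,3))?)
      (auto simp: conv_closed conv_assoc conv_one, auto simp: group_algebra_simps)
qed (auto simp: group_algebra_simps(2-5) conv_add)

lemma subring_group_algebra:
  assumes "group G" "subgroup H G"
  shows "subring (carrier (group_algebra (G\<lparr>carrier := H\<rparr>))) (group_algebra G)"
proof -
  interpret group G by fact
  interpret A: ring "group_algebra G" by (rule ring_group_algebra)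
  interpret H: group "G\<lparr>carrier := H\<rparr>"
    using assms(2) by (rule subgroup_imp_group)
  have conv: "conv (G\<lparr>carrier := H\<rparr>) = conv G" by (simp add: conv_def fun_eq_iff)
  have sub: "carrier (group_algebra (G\<lparr>carrier := H\<rparr>)) \<subseteq> carrier (group_algebra G)"
    using subgroup.subset[OF assms(2)] by (fastforce simp: group_algebra_simps)
  show ?thesis
  proof (rule A.subringI)
    fix f assume f: "f \<in> carrier (group_algebra (G\<lparr>carrier := H\<rparr>))"
    have "\<ominus>\<^bsub>group_algebra G\<^esub> f = (\<lambda>x. - f x)"
      by (rule A.minus_equality) (use f subgroup.subset[OF assms(2)] in \<open>fastforce simp: group_algebra_simps\<close>)+
    then show "\<ominus>\<^bsub>group_algebra G\<^esub> f \<in> carrier (group_algebra (G\<lparr>carrier := H\<rparr>))"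
      using f by (simp add: group_algebra_simps)
  next
    show "\<one>\<^bsub>group_algebra G\<^esub> \<in> carrier (group_algebra (G\<lparr>carrier := H\<rparr>))"
      using subgroup.one_closed[OF assms(2)] by (auto simp: group_algebra_simps)
  qed (use sub H.conv_closed in \<open>auto simp: group_algebra_simps(2,5) conv group_algebra_add_closed\<close>)
qed

end

theory Submission
  imports Defs
begin

text \<open>
  A second projection can be written down whenever \<open>H\<close> is a proper subgroup.  The element
  \<open>s = \<Sum>h\<in>H. h\<close> absorbs \<open>\<complex>H\<close> from both sides: \<open>b s = s b = \<epsilon>(b) s\<close>, where \<open>\<epsilon>\<close> sums the
  coefficients of \<open>b\<close>.  Likewise the functional \<open>\<tau>\<close> that sums the coefficients of an element of
  \<open>\<complex>G\<close> over \<open>carrier G - H\<close> satisfies \<open>\<tau>(b f) = \<tau>(f b) = \<epsilon>(b) \<tau>(f)\<close>, because translating by an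
  element of \<open>H\<close> permutes \<open>carrier G - H\<close>.  Hence \<open>f \<mapsto> \<tau>(f) s\<close> is a bimodule homomorphism
  from \<open>\<complex>G\<close> to \<open>\<complex>H\<close>; in representation-theoretic terms, it factors through the trivial
  \<open>H \<times> H\<close>-module, which is a quotient of \<open>\<complex>(G - H)\<close> and a submodule of \<open>\<complex>H\<close>.  It kills \<open>1\<close>, and it
  is nonzero as soon as \<open>G\<close> has an element outside \<open>H\<close>.

  Adding \<open>c\<close> times this map to the restriction of coefficients to \<open>H\<close> therefore gives a bimodule
  projection for every scalar \<open>c\<close> (\<open>split_map_bimodule_hom\<close> and \<open>split_map_one\<close>), and these differ
  for different \<open>c\<close> at any group element outside \<open>H\<close>.  So uniqueness forces \<open>H = carrier G\<close>.
\<close>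

text \<open>The map \<open>f \<mapsto> f|H + c \<tau>(f) s\<close>.\<close>

definition split_map ::
    "('a, 'm) monoid_scheme \<Rightarrow> 'a set \<Rightarrow> complex \<Rightarrow> ('a \<Rightarrow> complex) \<Rightarrow> 'a \<Rightarrow> complex" where
  "split_map G H c f = (\<lambda>x. if x \<in> H then f x + c * (\<Sum>y\<in>carrier G - H. f y) else 0)"

lemma carrier_group_algebra_finite:
  assumes "finite S"
  shows "f \<in> carrier (group_algebra (G\<lparr>carrier := S\<rparr>)) \<longleftrightarrow> (\<forall>x. x \<notin> S \<longrightarrow> f x = 0)"
  using assms finite_subset[of "{x. f x \<noteq> 0}" S] by (auto simp: group_algebra_simps)

context group
begin

text \<open>
  Solving \<open>y \<otimes> z = x\<close> for one factor turns the product with an element supported on \<open>S\<close> into a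
  linear combination of translates.
\<close>

lemma conv_eq_sum_translates:
  assumes "finite (carrier G)" "S \<subseteq> carrier G" "x \<in> carrier G"
    and b: "\<And>y. y \<notin> S \<Longrightarrow> b y = 0" and f: "\<And>y. y \<notin> carrier G \<Longrightarrow> f y = 0"
  shows "conv G b f x = (\<Sum>h\<in>S. b h * f (inv h \<otimes> x))"
    and "conv G f b x = (\<Sum>h\<in>S. b h * f (x \<otimes> inv h))"
proof -
  have fin: "finite S" using assms finite_subset by blast
  have sub: "{y. b y \<noteq> 0} \<subseteq> S" "{y. f y \<noteq> 0} \<subseteq> carrier G" using b f by auto
  have "conv G b f x = (\<Sum>h\<in>S. \<Sum>z\<in>carrier G. if h \<otimes> z = x then b h * f z else 0)"
    by (rule conv_superset[OF fin assms(1) sub])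
  also have "\<dots> = (\<Sum>h\<in>S. \<Sum>z\<in>carrier G. if z = inv h \<otimes> x then b h * f z else 0)"
    using assms(2,3) by (intro sum.cong refl if_cong) (auto simp: inv_solve_left subset_iff)
  also have "\<dots> = (\<Sum>h\<in>S. b h * f (inv h \<otimes> x))"
    using assms(1-3) by (intro sum.cong refl) (auto simp: subset_iff)
  finally show "conv G b f x = (\<Sum>h\<in>S. b h * f (inv h \<otimes> x))" .
  have "conv G f b x = (\<Sum>z\<in>carrier G. \<Sum>h\<in>S. if z \<otimes> h = x then f z * b h else 0)"
    by (rule conv_superset[OF assms(1) fin sub(2,1)])
  also have "\<dots> = (\<Sum>h\<in>S. \<Sum>z\<in>carrier G. if z \<otimes> h = x then f z * b h else 0)"
    by (rule sum.swap)
  also have "\<dots> = (\<Sum>h\<in>S. \<Sum>z\<in>carrier G. if z = x \<otimes> inv h then f z * b h else 0)"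
    using assms(2,3) by (intro sum.cong refl if_cong) (auto simp: inv_solve_right subset_iff)
  also have "\<dots> = (\<Sum>h\<in>S. b h * f (x \<otimes> inv h))"
    using assms(1-3) by (intro sum.cong refl) (auto simp: subset_iff mult.commute)
  finally show "conv G f b x = (\<Sum>h\<in>S. b h * f (x \<otimes> inv h))" .
qed

lemma subgroup_mult_mem_iff:
  assumes "subgroup H G" "h \<in> H" "x \<in> carrier G"
  shows "h \<otimes> x \<in> H \<longleftrightarrow> x \<in> H" and "x \<otimes> h \<in> H \<longleftrightarrow> x \<in> H"
proof -
  interpret H: subgroup H G by fact
  have "h \<in> carrier G" using assms by auto
  then have "inv h \<otimes> (h \<otimes> x) = x" "(x \<otimes> h) \<otimes> inv h = x"
    using assms(3) by (simp_all add: m_assoc[symmetric]) (simp add: m_assoc)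
  then show "h \<otimes> x \<in> H \<longleftrightarrow> x \<in> H" "x \<otimes> h \<in> H \<longleftrightarrow> x \<in> H"
    using assms(2) H.m_closed H.m_inv_closed by metis+
qed

lemma sum_translate_diff_subgroup:
  assumes "subgroup H G" "h \<in> H"
  shows "(\<Sum>y\<in>carrier G - H. f (inv h \<otimes> y)) = (\<Sum>y\<in>carrier G - H. f y)"
    and "(\<Sum>y\<in>carrier G - H. f (y \<otimes> inv h)) = (\<Sum>y\<in>carrier G - H. f y)"
proof -
  interpret H: subgroup H G by fact
  have h: "h \<in> carrier G" "inv h \<in> H" using assms by auto
  show "(\<Sum>y\<in>carrier G - H. f (inv h \<otimes> y)) = (\<Sum>y\<in>carrier G - H. f y)"
    by (rule sum.reindex_bij_witness[where i = "\<lambda>y. h \<otimes> y" and j = "\<lambda>y. inv h \<otimes> y"])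
      (use h assms in \<open>auto simp: m_assoc[symmetric] subgroup_mult_mem_iff\<close>)
  show "(\<Sum>y\<in>carrier G - H. f (y \<otimes> inv h)) = (\<Sum>y\<in>carrier G - H. f y)"
    by (rule sum.reindex_bij_witness[where i = "\<lambda>y. y \<otimes> h" and j = "\<lambda>y. y \<otimes> inv h"])
      (use h assms in \<open>auto simp: m_assoc subgroup_mult_mem_iff\<close>)
qed

text \<open>
  Both sides are expanded into translates by elements \<open>h\<close> of \<open>H\<close>; the value of \<open>split_map\<close>
  commutes with each translation separately, since \<open>H\<close> and its complement are both stable.
\<close>

lemma split_map_conv:
  assumes fin: "finite (carrier G)" and H: "subgroup H G" and x: "x \<in> carrier G"
    and b: "\<And>y. y \<notin> H \<Longrightarrow> b y = 0" and f: "\<And>y. y \<notin> carrier G \<Longrightarrow> f y = 0"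
  shows "split_map G H c (conv G b f) x = conv G b (split_map G H c f) x"
    and "split_map G H c (conv G f b) x = conv G (split_map G H c f) b x"
proof -
  interpret H: subgroup H G by fact
  have sf: "\<And>y. y \<notin> carrier G \<Longrightarrow> split_map G H c f y = 0"
    using H.subset by (auto simp: split_map_def)
  note conv_f = conv_eq_sum_translates[OF fin H.subset _ b f]
  have conv_sf:
      "conv G b (split_map G H c f) x = (\<Sum>h\<in>H. b h * split_map G H c f (inv h \<otimes> x))"
      "conv G (split_map G H c f) b x = (\<Sum>h\<in>H. b h * split_map G H c f (x \<otimes> inv h))"
    by (rule conv_eq_sum_translates[OF fin H.subset x]; use b sf in blast)+
  have "(\<Sum>y\<in>carrier G - H. conv G b f y) =
      (\<Sum>h\<in>H. b h * (\<Sum>y\<in>carrier G - H. f (inv h \<otimes> y)))"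
    by (simp add: conv_f sum_distrib_left) (rule sum.swap)
  also have "\<dots> = (\<Sum>h\<in>H. b h * (\<Sum>y\<in>carrier G - H. f y))"
    using H by (simp add: sum_translate_diff_subgroup)
  finally have left: "(\<Sum>y\<in>carrier G - H. conv G b f y) =
    (\<Sum>h\<in>H. b h * (\<Sum>y\<in>carrier G - H. f y))" .
  have "(\<Sum>y\<in>carrier G - H. conv G f b y) =
      (\<Sum>h\<in>H. b h * (\<Sum>y\<in>carrier G - H. f (y \<otimes> inv h)))"
    by (simp add: conv_f sum_distrib_left) (rule sum.swap)
  also have "\<dots> = (\<Sum>h\<in>H. b h * (\<Sum>y\<in>carrier G - H. f y))"
    using H by (simp add: sum_translate_diff_subgroup)
  finally have right: "(\<Sum>y\<in>carrier G - H. conv G f b y) =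
    (\<Sum>h\<in>H. b h * (\<Sum>y\<in>carrier G - H. f y))" .
  have mem: "inv h \<otimes> x \<in> H \<longleftrightarrow> x \<in> H" "x \<otimes> inv h \<in> H \<longleftrightarrow> x \<in> H" if "h \<in> H" for h
    using that H x by (simp_all add: subgroup_mult_mem_iff)
  show "split_map G H c (conv G b f) x = conv G b (split_map G H c f) x"
    unfolding conv_sf unfolding split_map_def left
    by (simp add: mem conv_f[OF x] sum_distrib_left distrib_left sum.distrib mult.left_commute)
  show "split_map G H c (conv G f b) x = conv G (split_map G H c f) b x"
    unfolding conv_sf unfolding split_map_def right
    by (simp add: mem conv_f[OF x] sum_distrib_left distrib_left sum.distrib mult.left_commute)
qed

lemma split_map_bimodule_hom:
  assumes fin: "finite (carrier G)" and H: "subgroup H G"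
  shows "restrict (split_map G H c) (carrier (group_algebra G)) \<in>
    bimodule_hom (group_algebra G) (carrier (group_algebra (G\<lparr>carrier := H\<rparr>)))"
proof -
  interpret H: subgroup H G by fact
  let ?A = "carrier (group_algebra G)" and ?B = "carrier (group_algebra (G\<lparr>carrier := H\<rparr>))"
  have A: "f \<in> ?A \<longleftrightarrow> (\<forall>x. x \<notin> carrier G \<longrightarrow> f x = 0)" for f
    using carrier_group_algebra_finite[OF fin, of f G] by simp
  have B: "f \<in> ?B \<longleftrightarrow> (\<forall>x. x \<notin> H \<longrightarrow> f x = 0)" for f
    using carrier_group_algebra_finite finite_subset[OF H.subset fin] by blast
  have BA: "f \<in> ?A" if "f \<in> ?B" for f
    using that H.subset by (auto simp: A B)
  have sB: "split_map G H c f \<in> ?B" for f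
    by (simp add: B split_map_def)
  have eqI: "f = g" if "f \<in> ?A" "g \<in> ?A" "\<And>x. x \<in> carrier G \<Longrightarrow> f x = g x" for f g
    using that unfolding A fun_eq_iff by metis
  have "split_map G H c (conv G b f) = conv G b (split_map G H c f)"
    and "split_map G H c (conv G f b) = conv G (split_map G H c f) b"
    if "b \<in> ?B" "f \<in> ?A" for b f
    using that(1)[unfolded B] that(2)[unfolded A]
    by (intro eqI conv_closed BA that sB split_map_conv[OF fin H]; blast)+
  moreover have "split_map G H c (\<lambda>x. f x + g x) =
      (\<lambda>x. split_map G H c f x + split_map G H c g x)" for f g
    by (auto simp: split_map_def fun_eq_iff sum.distrib distrib_left)
  ultimately show ?thesis
    using sB BA
    by (auto simp: bimodule_hom_def group_algebra_simps(2,5) group_algebra_add_closed conv_closed)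
qed

lemma split_map_one:
  assumes "subgroup H G"
  shows "split_map G H c \<one>\<^bsub>group_algebra G\<^esub> = \<one>\<^bsub>group_algebra G\<^esub>"
proof -
  have "(\<Sum>y\<in>carrier G - H. if y = \<one> then 1 else 0 :: complex) = 0"
    using subgroup.one_closed[OF assms] by (intro sum.neutral) auto
  then show ?thesis
    using subgroup.one_closed[OF assms] by (auto simp: split_map_def group_algebra_simps)
qed

end

theorem corollary4p6:
  fixes G :: "('a, 'm) monoid_scheme" and H :: "'a set"
  assumes "group G" and "finite (carrier G)" and "subgroup H G"
    and "uniquely_split (group_algebra G) (carrier (group_algebra (G\<lparr>carrier := H\<rparr>)))"
  shows "carrier (group_algebra G) = carrier (group_algebra (G\<lparr>carrier := H\<rparr>))"
proof -
  interpret group G by fact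
  interpret A: ring "group_algebra G" by (rule ring_group_algebra)
  interpret H: subgroup H G by fact
  let ?P = "\<lambda>c. restrict (split_map G H c) (carrier (group_algebra G))"
  have "?P c \<one>\<^bsub>group_algebra G\<^esub> = \<one>\<^bsub>group_algebra G\<^esub>" for c
    using split_map_one[OF assms(3)] by simp
  then have eq: "?P 0 = ?P 1"
    using assms(4) split_map_bimodule_hom[OF assms(2,3)] unfolding uniquely_split_def by blast
  have "carrier G \<subseteq> H"
  proof (rule ccontr)
    assume "\<not> carrier G \<subseteq> H"
    then obtain g where g: "g \<in> carrier G" "g \<notin> H" by blast
    define d :: "'a \<Rightarrow> complex" where "d = (\<lambda>x. if x = g then 1 else 0)"
    have "d \<in> carrier (group_algebra G)"
      using g by (auto simp: d_def group_algebra_simps)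
    then have "split_map G H 0 d \<one>\<^bsub>G\<^esub> = split_map G H 1 d \<one>\<^bsub>G\<^esub>"
      using fun_cong[OF eq, of d] by simp
    \<comment> \<open>At the identity the two sides are the coefficient of \<open>d\<close> there, which is \<open>0\<close>, and \<open>\<tau>(d) = 1\<close>.\<close>
    moreover have "d \<one>\<^bsub>G\<^esub> = 0" using g H.one_closed by (auto simp: d_def)
    moreover have "(\<Sum>y\<in>carrier G - H. d y) = 1"
      using g assms(2) by (simp add: d_def)
    ultimately show False by (simp add: split_map_def)
  qed
  then have "carrier G = H" using H.subset by blast
  then show ?thesis by auto
qed

end
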